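(* Let $n\ge 1$ and $I\subseteq[n]$. Let $\overline{L}_n(I)$ be the set of $\sigma\in S_n$ with $\overline{L}(\sigma)=I$, and $F_n(I)$ the set of $\sigma\in S_n$ with $F(\sigma)=I$. Then there is a bijection $\Phi:\overline{L}_n(I)\to F_n(I)$ such that for every $\sigma\in\overline{L}_n(I)$, $$\mathrm{jump}(\sigma)=\mathrm{exc}(\Phi(\sigma))\quad\text{and}\quad \mathrm{des}(\sigma)=\mathrm{drop}(\Phi(\sigma)).$$
   Context: $S_n$ is the set of permutations $\sigma=\sigma_1\cdots\sigma_n$ of $[n]$, with the convention $\sigma_0=0$. $\overline{L}(\sigma)=\{\sigma_i : 1\le i\le n,\ \sigma_{i-1}+1=\sigma_i\}$ (the set of values at left successions), and $F(\sigma)=\{i : 1\le i\le n,\ \sigma_i=i\}$ (the set of fixed points). $\mathrm{jump}(\sigma)$ is the number of indices $1\le i\le n$ with $\sigma_i\ge\sigma_{i-1}+2$; $\mathrm{des}(\sigma)$ is the number of indices $1\le i\le n-1$ with $\sigma_i>\sigma_{i+1}$; $\mathrm{exc}(\sigma)$ and $\mathrm{drop}(\sigma)$ are the numbers of indices $1\le i\le n$ with $\sigma_i>i$ and $\sigma_i<i$, respectively. *)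

theory Defs
  imports "HOL-Combinatorics.Permutations"
begin

text \<open>
  A permutation of \<open>[n]\<close> is a function \<open>\<sigma> :: nat \<Rightarrow> nat\<close> with \<open>\<sigma> permutes {1..n}\<close>; its word is
  \<open>\<sigma> 1, \<dots>, \<sigma> n\<close>.  As such a function is the identity off \<open>{1..n}\<close>, the convention
  \<open>\<sigma>\<^sub>0 = 0\<close> holds automatically, and \<open>\<sigma> (i - 1)\<close> at \<open>i = 1\<close> below is \<open>\<sigma> 0 = 0\<close>.
\<close>

definition left_succ_values :: "nat \<Rightarrow> (nat \<Rightarrow> nat) \<Rightarrow> nat set" where
  "left_succ_values n \<sigma> = {\<sigma> i | i. i \<in> {1..n} \<and> \<sigma> (i - 1) + 1 = \<sigma> i}"

definition fixed_points :: "nat \<Rightarrow> (nat \<Rightarrow> nat) \<Rightarrow> nat set" where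
  "fixed_points n \<sigma> = {i \<in> {1..n}. \<sigma> i = i}"

definition jump_count :: "nat \<Rightarrow> (nat \<Rightarrow> nat) \<Rightarrow> nat" where
  "jump_count n \<sigma> = card {i \<in> {1..n}. \<sigma> i \<ge> \<sigma> (i - 1) + 2}"

text \<open>The half-open range is \<open>1 \<le> i \<le> n - 1\<close>: there is no descent at position \<open>n\<close>.\<close>

definition des_count :: "nat \<Rightarrow> (nat \<Rightarrow> nat) \<Rightarrow> nat" where
  "des_count n \<sigma> = card {i \<in> {1..<n}. \<sigma> i > \<sigma> (i + 1)}"

definition exc_count :: "nat \<Rightarrow> (nat \<Rightarrow> nat) \<Rightarrow> nat" where
  "exc_count n \<sigma> = card {i \<in> {1..n}. \<sigma> i > i}"

definition drop_count :: "nat \<Rightarrow> (nat \<Rightarrow> nat) \<Rightarrow> nat" where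
  "drop_count n \<sigma> = card {i \<in> {1..n}. \<sigma> i < i}"

definition perms_with_left_succ :: "nat \<Rightarrow> nat set \<Rightarrow> (nat \<Rightarrow> nat) set" where
  "perms_with_left_succ n I = {\<sigma>. \<sigma> permutes {1..n} \<and> left_succ_values n \<sigma> = I}"

definition perms_with_fixed_points :: "nat \<Rightarrow> nat set \<Rightarrow> (nat \<Rightarrow> nat) set" where
  "perms_with_fixed_points n I = {\<sigma>. \<sigma> permutes {1..n} \<and> fixed_points n \<sigma> = I}"

end

theory Submission
  imports Defs
begin

text \<open>
  Both statistics obey the same recursion under insertion of a new largest value \<open>n\<close>.  On words,
  \<open>n\<close> is inserted between two consecutive letters (or at the end); on cycles, \<open>n\<close> is inserted on an
  arc \<open>i \<mapsto> \<pi> i\<close> or made a fixed point.  Inserting \<open>n\<close> right after \<open>n - 1\<close> creates the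
  succession \<open>n\<close>, as making \<open>n\<close> a fixed point does; inserting it into a succession (at a fixed
  point) destroys that one and adds a descent (drop); into a jump (exceedance), it adds a descent
  (drop); and there remain exactly as many places without effect as there are descents (drops),
  since the end of the word compensates for the place after \<open>n - 1\<close>.  Hence \<open>(L, des)\<close> and
  \<open>(F, drop)\<close> are equidistributed on \<open>S\<^sub>n\<close>, and jumps and exceedances are the remaining indices.
\<close>

section \<open>From equal fibre sizes to a bijection\<close>

text \<open>The fibres of \<open>f\<close> partition \<open>A\<close>, those of \<open>g\<close>
  partition \<open>B\<close>, and fibres of equal size are in bijection; gluing these bijections
  along the common value \<open>k\<close> gives \<Phi>. This turns a counting identity into the
  required map.\<close>

lemma ex_bij_betw_preserving:
  assumes "finite A" "finite B"
    and fibres: "\<And>k. card {x \<in> A. f x = k} = card {y \<in> B. g y = k}"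
  shows "\<exists>\<Phi>. bij_betw \<Phi> A B \<and> (\<forall>x\<in>A. g (\<Phi> x) = f x)"
proof -
  have "\<exists>h. bij_betw h {x \<in> A. f x = k} {y \<in> B. g y = k}" for k
    using assms by (intro finite_same_card_bij) auto
  then obtain h where h: "\<And>k. bij_betw (h k) {x \<in> A. f x = k} {y \<in> B. g y = k}"
    by metis
  define \<Phi> where "\<Phi> x = h (f x) x" for x
  have \<Phi>: "\<Phi> x \<in> B \<and> g (\<Phi> x) = f x" if "x \<in> A" for x
    using bij_betwE[OF h[of "f x"]] that by (auto simp: \<Phi>_def)
  have "inj_on \<Phi> A"
  proof (rule inj_onI)
    fix x y assume xy: "x \<in> A" "y \<in> A" "\<Phi> x = \<Phi> y"
    then have "f x = f y" using \<Phi> by metis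
    with xy show "x = y"
      using bij_betw_imp_inj_on[OF h[of "f x"]] by (auto simp: \<Phi>_def dest: inj_onD)
  qed
  moreover have "B \<subseteq> \<Phi> ` A"
  proof
    fix y assume "y \<in> B"
    then have "y \<in> h (g y) ` {x \<in> A. f x = g y}"
      using bij_betw_imp_surj_on[OF h[of "g y"]] by auto
    then obtain x where "x \<in> A" "f x = g y" "y = h (g y) x" by blast
    then show "y \<in> \<Phi> ` A" by (metis \<Phi>_def image_eqI)
  qed
  ultimately show ?thesis using \<Phi> by (intro exI[of _ \<Phi>]) (auto simp: bij_betw_def)
qed

section \<open>Successions, descents and jumps as gaps of a word\<close>

text \<open>In this and the next two definitions, \<open>q\<close> indexes the gap between the
  letters at positions \<open>q\<close> and \<open>q + 1\<close>; gap 0 follows the conventional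
  letter 0. Gaps are also the places where a new letter can be inserted, the end of the word being
  the additional place \<open>n\<close>.\<close>

definition succ_positions :: "nat \<Rightarrow> (nat \<Rightarrow> nat) \<Rightarrow> nat set" where
  "succ_positions n \<sigma> = {q. q < n \<and> \<sigma> (Suc q) = Suc (\<sigma> q)}"

definition des_positions :: "nat \<Rightarrow> (nat \<Rightarrow> nat) \<Rightarrow> nat set" where
  "des_positions n \<sigma> = {q. q < n \<and> \<sigma> (Suc q) < \<sigma> q}"

definition jump_positions :: "nat \<Rightarrow> (nat \<Rightarrow> nat) \<Rightarrow> nat set" where
  "jump_positions n \<sigma> = {q. q < n \<and> Suc (\<sigma> q) < \<sigma> (Suc q)}"

lemma finite_positions [simp]:
  "finite (succ_positions n \<sigma>)" "finite (des_positions n \<sigma>)" "finite (jump_positions n \<sigma>)"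
  by (simp_all add: succ_positions_def des_positions_def jump_positions_def)

lemma left_succ_values_eq:
  "left_succ_values n \<sigma> = (\<lambda>q. \<sigma> (Suc q)) ` succ_positions n \<sigma>"
proof (intro equalityI subsetI)
  fix v assume "v \<in> left_succ_values n \<sigma>"
  then obtain i where "v = \<sigma> i" "i \<in> {1..n}" "\<sigma> (i - 1) + 1 = \<sigma> i"
    by (auto simp: left_succ_values_def)
  then show "v \<in> (\<lambda>q. \<sigma> (Suc q)) ` succ_positions n \<sigma>"
    by (intro image_eqI[of _ _ "i - 1"]) (auto simp: succ_positions_def)
next
  fix v assume "v \<in> (\<lambda>q. \<sigma> (Suc q)) ` succ_positions n \<sigma>"
  then obtain q where "v = \<sigma> (Suc q)" "q < n" "\<sigma> (Suc q) = Suc (\<sigma> q)"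
    by (auto simp: succ_positions_def)
  then show "v \<in> left_succ_values n \<sigma>"
    by (auto simp: left_succ_values_def intro!: exI[of _ "Suc q"])
qed

lemma permutes_fixes_0: "\<sigma> permutes {1..n} \<Longrightarrow> \<sigma> 0 = (0::nat)"
  by (simp add: permutes_not_in)

lemma des_count_eq:
  assumes "\<sigma> permutes {1..n}"
  shows "des_count n \<sigma> = card (des_positions n \<sigma>)"
proof -
  \<comment> \<open>Gap 0 lies outside the range of \<open>des_count\<close>, but it is never a
    descent because \<open>\<sigma> 0 = 0\<close>.\<close>
  have "{i \<in> {1..<n}. \<sigma> i > \<sigma> (i + 1)} = des_positions n \<sigma>"
    using permutes_fixes_0[OF assms]
    by (auto simp: des_positions_def Suc_le_eq intro!: gr0I)
  then show ?thesis by (simp add: des_count_def)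
qed

lemma jump_count_eq: "jump_count n \<sigma> = card (jump_positions n \<sigma>)"
proof -
  have "bij_betw Suc (jump_positions n \<sigma>) {i \<in> {1..n}. \<sigma> i \<ge> \<sigma> (i - 1) + 2}"
    by (rule bij_betw_byWitness[of _ "\<lambda>i. i - 1"]) (auto simp: jump_positions_def)
  then show ?thesis unfolding jump_count_def by (rule bij_betw_same_card[symmetric])
qed

lemma inj_on_shift: "\<sigma> permutes {1..n} \<Longrightarrow> inj_on (\<lambda>q. \<sigma> (Suc q)) A"
  by (rule inj_onI) (metis Suc_inject permutes_inj injD)

lemma card_left_succ_values:
  assumes "\<sigma> permutes {1..n}"
  shows "card (left_succ_values n \<sigma>) = card (succ_positions n \<sigma>)"
  unfolding left_succ_values_eq by (intro card_image inj_on_shift[OF assms])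

lemma positions_partition:
  assumes "\<sigma> permutes {1..n}"
  shows "{..<n} = succ_positions n \<sigma> \<union> (jump_positions n \<sigma> \<union> des_positions n \<sigma>)"
proof -
  have "\<sigma> (Suc q) \<noteq> \<sigma> q" for q
    using permutes_inj[OF assms] by (metis injD n_not_Suc_n)
  then have "\<sigma> (Suc q) = Suc (\<sigma> q) \<or> Suc (\<sigma> q) < \<sigma> (Suc q) \<or> \<sigma> (Suc q) < \<sigma> q" for q
    by (metis Suc_lessI linorder_neqE_nat)
  then show ?thesis
    by (auto simp: succ_positions_def jump_positions_def des_positions_def)
qed

text \<open>The three kinds partition the \<open>n\<close> gaps, and distinct successions have
  distinct values by injectivity. Together with \<open>exc_drop_sum\<close> this makes jumps and
  exceedances follow from the other two statistics.\<close>

lemma jump_des_sum: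
  assumes "\<sigma> permutes {1..n}"
  shows "jump_count n \<sigma> + des_count n \<sigma> + card (left_succ_values n \<sigma>) = n"
proof -
  have "card {..<n} = card (succ_positions n \<sigma>) + (card (jump_positions n \<sigma>) + card (des_positions n \<sigma>))"
    unfolding positions_partition[OF assms]
    by (subst card_Un_disjoint; (subst card_Un_disjoint)?)
      (auto simp: succ_positions_def jump_positions_def des_positions_def)
  then show ?thesis
    by (simp add: card_left_succ_values[OF assms] jump_count_eq des_count_eq[OF assms])
qed

lemma exc_drop_sum: "exc_count n \<pi> + drop_count n \<pi> + card (fixed_points n \<pi>) = n"
proof -
  have "card {1..n} = card ({i \<in> {1..n}. \<pi> i > i} \<union> ({i \<in> {1..n}. \<pi> i < i} \<union> fixed_points n \<pi>))"
    by (rule arg_cong[of _ _ card]) (auto simp: fixed_points_def)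
  also have "\<dots> = exc_count n \<pi> + (drop_count n \<pi> + card (fixed_points n \<pi>))"
    unfolding exc_count_def drop_count_def fixed_points_def
    by (subst card_Un_disjoint; (subst card_Un_disjoint)?) auto
  finally show ?thesis by simp
qed

section \<open>The recursion for fixed points and drops\<close>

text \<open>The total weight \<open>f\<close> of the \<open>m + 1\<close> permutations obtained from
  one of \<open>[m]\<close> with set \<open>X\<close> and \<open>d\<close> descents (drops). The
  terms stand, in order, for creating the element \<open>m + 1\<close>, destroying one element of
  \<open>X\<close>, hitting a jump (exceedance), and the places without effect. Only
  \<open>X\<close> and \<open>d\<close> enter, so the result is again a weight of the same
  kind.\<close>

definition insertion_sum :: "nat \<Rightarrow> (nat set \<Rightarrow> nat \<Rightarrow> nat) \<Rightarrow> nat set \<Rightarrow> nat \<Rightarrow> nat" where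
  "insertion_sum m f X d = f (insert (Suc m) X) d + (\<Sum>i\<in>X. f (X - {i}) (Suc d))
     + (m - card X - d) * f X (Suc d) + d * f X d"

text \<open>Every permutation of \<open>[m + 1]\<close> is uniquely
  \<open>transpose (Suc m) b \<circ> \<pi>\<close> with \<pi> a permutation of \<open>[m]\<close>.
  Grouping by \<pi>, the inner sum over \<open>b\<close> is evaluated according to the kind of arc
  that is subdivided.\<close>

lemma sum_fixed_points_Suc:
  fixes f :: "nat set \<Rightarrow> nat \<Rightarrow> nat"
  shows "(\<Sum>\<pi> | \<pi> permutes {1..Suc m}. f (fixed_points (Suc m) \<pi>) (drop_count (Suc m) \<pi>)) =
    (\<Sum>\<pi> | \<pi> permutes {1..m}. insertion_sum m f (fixed_points m \<pi>) (drop_count m \<pi>))"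
proof -
  let ?g = "\<lambda>\<pi>. f (fixed_points (Suc m) \<pi>) (drop_count (Suc m) \<pi>)"
  have ins: "{1..Suc m} = insert (Suc m) {1..m}" by auto
  have "sum ?g {\<pi>. \<pi> permutes {1..Suc m}} =
      (\<Sum>b\<in>insert (Suc m) {1..m}. \<Sum>\<pi> | \<pi> permutes {1..m}. ?g (transpose (Suc m) b \<circ> \<pi>))"
    unfolding ins by (rule sum_over_permutations_insert) auto
  also have "\<dots> = (\<Sum>\<pi> | \<pi> permutes {1..m}. \<Sum>b\<in>insert (Suc m) {1..m}. ?g (transpose (Suc m) b \<circ> \<pi>))"
    by (rule sum.swap)
  also have "\<dots> = (\<Sum>\<pi> | \<pi> permutes {1..m}. insertion_sum m f (fixed_points m \<pi>) (drop_count m \<pi>))"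
  proof (rule sum.cong[OF refl])
    fix \<pi> assume "\<pi> \<in> {\<pi>. \<pi> permutes {1..m}}"
    then have \<pi>: "\<pi> permutes {1..m}" by simp
    define D E F where "D = {i \<in> {1..m}. \<pi> i < i}" and "E = {i \<in> {1..m}. \<pi> i > i}"
      and "F = fixed_points m \<pi>"
    have fin: "finite D" "finite E" "finite F"
      by (auto simp: D_def E_def F_def fixed_points_def)
    have D: "drop_count m \<pi> = card D" and E: "exc_count m \<pi> = card E"
      by (auto simp: D_def E_def drop_count_def exc_count_def)
    have last: "\<pi> (Suc m) = Suc m" using \<pi> by (simp add: permutes_not_in)
    have in_range: "\<pi> i \<in> {1..m}" if "i \<in> {1..m}" for i
      using permutes_in_image[OF \<pi>] that by blast
    have g_last: "?g \<pi> = f (insert (Suc m) F) (card D)"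
    proof -
      have "fixed_points (Suc m) \<pi> = insert (Suc m) F"
        using last by (auto simp: F_def fixed_points_def le_Suc_eq)
      moreover have "{i \<in> {1..Suc m}. \<pi> i < i} = D"
        using last by (auto simp: D_def le_Suc_eq)
      ultimately show ?thesis by (simp add: drop_count_def)
    qed
    \<comment> \<open>The arc from \<open>i\<close> to \<open>\<pi> i\<close> becomes
      \<open>i\<close>, \<open>m + 1\<close>, \<open>\<pi> i\<close>. Thus \<open>m + 1\<close> is a
      drop and \<open>i\<close> an exceedance, whatever \<open>i\<close> was before.\<close>
    have g_ins: "?g (transpose (Suc m) (\<pi> i) \<circ> \<pi>) = f (F - {i}) (Suc (card (D - {i})))"
      if i: "i \<in> {1..m}" for i
    proof -
      let ?\<tau> = "transpose (Suc m) (\<pi> i) \<circ> \<pi>"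
      have \<tau>_i: "?\<tau> i = Suc m" by simp
      have \<tau>_last: "?\<tau> (Suc m) = \<pi> i" using last by simp
      have \<tau>: "?\<tau> j = \<pi> j" if "j \<in> {1..m}" "j \<noteq> i" for j
      proof -
        have "\<pi> j \<noteq> \<pi> i" using permutes_inj[OF \<pi>] that by (auto dest: injD)
        with in_range[OF that(1)] show ?thesis by (auto simp: transpose_def)
      qed
      have split: "j \<in> {1..Suc m} \<longleftrightarrow> j = i \<or> j = Suc m \<or> (j \<in> {1..m} \<and> j \<noteq> i)" for j
        using i by auto
      have "fixed_points (Suc m) ?\<tau> = F - {i}"
        unfolding fixed_points_def split F_def
        using i \<tau>_i \<tau>_last \<tau> in_range[OF i] by (auto simp del: o_apply)
      moreover have "{j \<in> {1..Suc m}. ?\<tau> j < j} = insert (Suc m) (D - {i})"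
        unfolding split D_def
        using i \<tau>_i \<tau>_last \<tau> in_range[OF i] by (auto simp del: o_apply)
      moreover have "Suc m \<notin> D" by (simp add: D_def)
      ultimately show ?thesis using fin by (simp add: drop_count_def)
    qed
    have part: "{1..m} = F \<union> (E \<union> D)" by (auto simp: D_def E_def F_def fixed_points_def)
    have "(\<Sum>b\<in>insert (Suc m) {1..m}. ?g (transpose (Suc m) b \<circ> \<pi>)) =
        ?g \<pi> + (\<Sum>b\<in>{1..m}. ?g (transpose (Suc m) b \<circ> \<pi>))"
      by simp
    \<comment> \<open>Substituting \<open>b = \<pi> i\<close> indexes the arcs by their source
      instead of their target.\<close>
    also have "(\<Sum>b\<in>{1..m}. ?g (transpose (Suc m) b \<circ> \<pi>)) =
        (\<Sum>i\<in>{1..m}. ?g (transpose (Suc m) (\<pi> i) \<circ> \<pi>))"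
      using sum.permute[OF \<pi>, of "\<lambda>b. ?g (transpose (Suc m) b \<circ> \<pi>)"] by (simp add: o_def)
    also have "\<dots> = (\<Sum>i\<in>F \<union> (E \<union> D). f (F - {i}) (Suc (card (D - {i}))))"
      unfolding part[symmetric] using g_ins by (rule sum.cong[OF refl])
    also have "\<dots> = (\<Sum>i\<in>F. f (F - {i}) (Suc (card (D - {i})))) +
        ((\<Sum>i\<in>E. f (F - {i}) (Suc (card (D - {i})))) + (\<Sum>i\<in>D. f (F - {i}) (Suc (card (D - {i})))))"
      using fin by (subst sum.union_disjoint; (subst sum.union_disjoint)?)
        (auto simp: D_def E_def F_def fixed_points_def)
    also have "(\<Sum>i\<in>F. f (F - {i}) (Suc (card (D - {i})))) = (\<Sum>i\<in>F. f (F - {i}) (Suc (card D)))"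
      by (rule sum.cong) (auto simp: D_def F_def fixed_points_def)
    also have "(\<Sum>i\<in>E. f (F - {i}) (Suc (card (D - {i})))) = (\<Sum>i\<in>E. f F (Suc (card D)))"
    proof (rule sum.cong[OF refl])
      fix i assume "i \<in> E"
      then have "i \<notin> F" "i \<notin> D" by (auto simp: D_def E_def F_def fixed_points_def)
      then show "f (F - {i}) (Suc (card (D - {i}))) = f F (Suc (card D))" by simp
    qed
    \<comment> \<open>On the arc of a drop, the drop at \<open>i\<close> is traded for the one at
      \<open>m + 1\<close>.\<close>
    also have "(\<Sum>i\<in>D. f (F - {i}) (Suc (card (D - {i})))) = (\<Sum>i\<in>D. f F (card D))"
    proof (rule sum.cong[OF refl])
      fix i assume i: "i \<in> D"
      then have "i \<notin> F" by (auto simp: D_def F_def fixed_points_def)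
      then show "f (F - {i}) (Suc (card (D - {i}))) = f F (card D)"
        using card_Suc_Diff1[OF fin(1) i] by simp
    qed
    finally have "(\<Sum>b\<in>insert (Suc m) {1..m}. ?g (transpose (Suc m) b \<circ> \<pi>)) =
        ?g \<pi> + ((\<Sum>i\<in>F. f (F - {i}) (Suc (card D))) + (card E * f F (Suc (card D)) + card D * f F (card D)))"
      by (simp add: o_def)
    moreover have "card E = m - card F - card D"
      using exc_drop_sum[of m \<pi>] by (simp add: D E F_def)
    ultimately show "(\<Sum>b\<in>insert (Suc m) {1..m}. ?g (transpose (Suc m) b \<circ> \<pi>)) =
        insertion_sum m f (fixed_points m \<pi>) (drop_count m \<pi>)"
      using g_last by (simp only: insertion_sum_def D flip: F_def)
  qed
  finally show ?thesis .
qed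

section \<open>Insertion of the largest letter into a word\<close>

text \<open>For \<open>p \<le> m\<close>, a cycle on the positions \<open>p + 1, ..., m + 1\<close>.
  A permutation of \<open>[m]\<close> fixes \<open>m + 1\<close>, so after composing with this cycle
  it reads \<open>m + 1\<close> at position \<open>p + 1\<close> and its old letters one place later
  from there on.\<close>

definition shift_perm :: "nat \<Rightarrow> nat \<Rightarrow> nat \<Rightarrow> nat" where
  "shift_perm m p i =
    (if i \<le> p \<or> Suc m < i then i else if i = Suc p then Suc m else i - 1)"

lemma shift_perm_simps:
  "i \<le> p \<Longrightarrow> shift_perm m p i = i"
  "p \<le> m \<Longrightarrow> shift_perm m p (Suc p) = Suc m"
  "p < i \<Longrightarrow> i \<le> m \<Longrightarrow> shift_perm m p (Suc i) = i"
  by (auto simp: shift_perm_def)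

lemma shift_perm_permutes:
  assumes "p \<le> m"
  shows "shift_perm m p permutes {1..Suc m}"
proof (rule inj_imp_permutes)
  show "inj_on (shift_perm m p) {1..Suc m}"
    by (rule inj_onI) (auto simp: shift_perm_def split: if_splits)
qed (use assms in \<open>auto simp: shift_perm_def\<close>)

text \<open>\<open>\<sigma> \<circ> shift_perm m p\<close> is the word of \<open>\<sigma>\<close> with \<open>m + 1\<close> inserted after position \<open>p\<close>.\<close>

lemma word_insert_permutes:
  assumes "\<sigma> permutes {1..m}" and "p \<le> m"
  shows "\<sigma> \<circ> shift_perm m p permutes {1..Suc m}"
proof (rule permutes_compose)
  show "\<sigma> permutes {1..Suc m}" by (rule permutes_subset[OF assms(1)]) auto
qed (rule shift_perm_permutes[OF assms(2)])

text \<open>Insertion is injective on pairs of a word and a place; surjectivity then follows by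
  counting, as \<open>m! * (m + 1) = (m + 1)!\<close>.\<close>

lemma sum_permutations_word_insert:
  "(\<Sum>\<sigma> | \<sigma> permutes {1..Suc m}. g \<sigma>) =
    (\<Sum>\<sigma> | \<sigma> permutes {1..m}. \<Sum>p\<le>m. g (\<sigma> \<circ> shift_perm m p))"
proof -
  let ?A = "{\<sigma>. \<sigma> permutes {1..m}} \<times> {..m}" and ?B = "{\<sigma>. \<sigma> permutes {1..Suc m}}"
  let ?h = "\<lambda>(\<sigma>, p). \<sigma> \<circ> shift_perm m p"
  have fin: "finite ?B" by (simp add: finite_permutations)
  have "inj_on ?h ?A"
  proof (rule inj_onI)
    fix x y assume xy: "x \<in> ?A" "y \<in> ?A" "?h x = ?h y"
    obtain \<sigma> p \<tau> q where [simp]: "x = (\<sigma>, p)" "y = (\<tau>, q)" by (cases x, cases y)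
    have \<sigma>: "\<sigma> permutes {1..m}" and \<tau>: "\<tau> permutes {1..m}" and p: "p \<le> m" and q: "q \<le> m"
      and eq: "\<sigma> \<circ> shift_perm m p = \<tau> \<circ> shift_perm m q"
      using xy by auto
    \<comment> \<open>The letter \<open>m + 1\<close> stands at position \<open>p + 1\<close> in one
      word and \<open>q + 1\<close> in the other, so equal words force \<open>p = q\<close>.\<close>
    have "\<tau> (shift_perm m q (Suc p)) = Suc m"
      using fun_cong[OF eq, of "Suc p"] p \<sigma> by (simp add: shift_perm_simps permutes_not_in)
    also have "\<dots> = \<tau> (shift_perm m q (Suc q))"
      using q \<tau> by (simp add: shift_perm_simps permutes_not_in)
    finally have "p = q"
      using permutes_inj[OF \<tau>] permutes_inj[OF shift_perm_permutes[of q m]] q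
      by (auto dest!: injD)
    moreover have "surj (shift_perm m p)"
      using p by (intro permutes_surj[OF shift_perm_permutes]) simp
    ultimately have "\<sigma> = \<tau>"
      using eq by (intro surj_fun_eq[of "shift_perm m p"]) auto
    with \<open>p = q\<close> show "x = y" by simp
  qed
  moreover have "?h ` ?A \<subseteq> ?B"
    using word_insert_permutes by auto
  moreover have "card ?A = card ?B"
    using card_permutations[of "{1..m}" m] card_permutations[of "{1..Suc m}" "Suc m"]
    by (simp add: card_cartesian_product)
  ultimately have "bij_betw ?h ?A ?B"
    by (intro bij_betw_imageI card_subset_eq[OF fin]) (simp_all only: card_image)
  then have "sum g ?B = (\<Sum>x\<in>?A. g (?h x))"
    by (rule sum.reindex_bij_betw[symmetric])
  then show ?thesis
    by (simp add: sum.cartesian_product case_prod_unfold)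
qed

text \<open>Gaps before \<open>p\<close> stay, gaps after \<open>p\<close> move up by one, and gap
  \<open>p\<close> splits in two: an ascent to \<open>m + 1\<close> at \<open>p\<close> and a
  descent from it at \<open>p + 1\<close>. The latter is missing when \<open>p = m\<close>, where
  \<open>m + 1\<close> ends the word.\<close>

lemma des_positions_insert:
  assumes \<sigma>: "\<sigma> permutes {1..m}" and p: "p \<le> m"
  shows "des_positions (Suc m) (\<sigma> \<circ> shift_perm m p) =
    {q \<in> des_positions m \<sigma>. q < p} \<union> Suc ` ({q \<in> des_positions m \<sigma>. p < q} \<union> (if p < m then {p} else {}))"
    (is "_ = ?R")
proof -
  let ?\<tau> = "\<sigma> \<circ> shift_perm m p"
  have last: "\<sigma> (Suc m) = Suc m" using \<sigma> by (simp add: permutes_not_in)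
  have le: "\<sigma> i \<le> m" if "i \<le> m" for i
    using permutes_in_image[OF \<sigma>, of i] permutes_fixes_0[OF \<sigma>] that by (cases "i = 0") auto
  have "q \<in> des_positions (Suc m) ?\<tau> \<longleftrightarrow> q \<in> ?R" for q
  proof -
    consider "q < p" | "q = p" | "q = Suc p" | r where "q = Suc r" "p < r"
      by (metis less_antisym not_less_eq Suc_lessI less_imp_Suc_add linorder_neqE_nat)
    then show ?thesis
    proof cases
      case 1
      then show ?thesis using p by (auto simp: des_positions_def shift_perm_simps)
    next
      case 2
      then show ?thesis using p le[of p] last
        by (auto simp: des_positions_def shift_perm_simps)
    next
      case 3
      then show ?thesis using p last le[of "Suc p"]
        by (auto simp: des_positions_def shift_perm_simps)
    next
      case 4
      then show ?thesis using p
        by (cases "r < m") (auto simp: des_positions_def shift_perm_simps)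
    qed
  qed
  then show ?thesis by blast
qed

text \<open>One formula serves all places: in a descent gap with \<open>p < m\<close> the loss of
  \<open>p\<close> and the new descent cancel.\<close>

lemma des_count_insert:
  assumes \<sigma>: "\<sigma> permutes {1..m}" and p: "p \<le> m"
  shows "des_count (Suc m) (\<sigma> \<circ> shift_perm m p) =
    card (des_positions m \<sigma> - {p}) + (if p < m then 1 else 0)"
proof -
  let ?D = "des_positions m \<sigma>"
  have split: "?D - {p} = {q \<in> ?D. q < p} \<union> {q \<in> ?D. p < q}" by auto
  have "card (?D - {p}) = card {q \<in> ?D. q < p} + card {q \<in> ?D. p < q}"
    unfolding split by (rule card_Un_disjoint) auto
  moreover have "card (des_positions (Suc m) (\<sigma> \<circ> shift_perm m p)) =
      card {q \<in> ?D. q < p} + card ({q \<in> ?D. p < q} \<union> (if p < m then {p} else {}))"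
    unfolding des_positions_insert[OF assms]
    by (subst card_Un_disjoint) (auto simp: card_image)
  moreover have "card ({q \<in> ?D. p < q} \<union> (if p < m then {p} else {})) =
      card {q \<in> ?D. p < q} + (if p < m then 1 else 0)"
    by (subst card_Un_disjoint) auto
  ultimately show ?thesis by (simp add: des_count_eq[OF word_insert_permutes[OF assms]])
qed

text \<open>Of the two gaps replacing gap \<open>p\<close>, the second cannot be a succession, and
  the first is one exactly when \<open>m + 1\<close> follows \<open>m\<close>. For
  \<open>m = 0\<close> the conventional letter 0 plays the role of \<open>m\<close>.\<close>

lemma left_succ_values_insert:
  assumes \<sigma>: "\<sigma> permutes {1..m}" and p: "p \<le> m"
  shows "left_succ_values (Suc m) (\<sigma> \<circ> shift_perm m p) =
    (\<lambda>q. \<sigma> (Suc q)) ` (succ_positions m \<sigma> - {p}) \<union> (if \<sigma> p = m then {Suc m} else {})"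
proof -
  let ?\<tau> = "\<sigma> \<circ> shift_perm m p"
  let ?S = "succ_positions m \<sigma>"
  have last: "\<sigma> (Suc m) = Suc m" using \<sigma> by (simp add: permutes_not_in)
  have le: "\<sigma> i \<le> m" if "i \<le> m" for i
    using permutes_in_image[OF \<sigma>, of i] permutes_fixes_0[OF \<sigma>] that by (cases "i = 0") auto
  have "q \<in> succ_positions (Suc m) ?\<tau> \<longleftrightarrow>
      q \<in> {q \<in> ?S. q < p} \<union> Suc ` {q \<in> ?S. p < q} \<union> (if \<sigma> p = m then {p} else {})" for q
  proof -
    consider "q < p" | "q = p" | "q = Suc p" | r where "q = Suc r" "p < r"
      by (metis less_antisym not_less_eq Suc_lessI less_imp_Suc_add linorder_neqE_nat)
    then show ?thesis
    proof cases
      case 1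
      then show ?thesis using p by (auto simp: succ_positions_def shift_perm_simps)
    next
      case 2
      then show ?thesis using p last
        by (auto simp: succ_positions_def shift_perm_simps)
    next
      case 3
      then show ?thesis using p last le[of "Suc p"]
        by (auto simp: succ_positions_def shift_perm_simps)
    next
      case 4
      then show ?thesis using p
        by (cases "r < m") (auto simp: succ_positions_def shift_perm_simps)
    qed
  qed
  then have S: "succ_positions (Suc m) ?\<tau> =
      {q \<in> ?S. q < p} \<union> Suc ` {q \<in> ?S. p < q} \<union> (if \<sigma> p = m then {p} else {})"
    by blast
  \<comment> \<open>Successions on either side of the insertion may change position but keep their
    values.\<close>
  have "(\<lambda>q. ?\<tau> (Suc q)) ` {q \<in> ?S. q < p} = (\<lambda>q. \<sigma> (Suc q)) ` {q \<in> ?S. q < p}"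
    by (rule image_cong) (auto simp: shift_perm_simps)
  moreover have "(\<lambda>q. ?\<tau> (Suc q)) ` Suc ` {q \<in> ?S. p < q} = (\<lambda>q. \<sigma> (Suc q)) ` {q \<in> ?S. p < q}"
    unfolding image_image
    by (rule image_cong) (auto simp: shift_perm_simps succ_positions_def)
  moreover have "?\<tau> (Suc p) = Suc m" using p last by (simp add: shift_perm_simps)
  moreover have "?S - {p} = {q \<in> ?S. q < p} \<union> {q \<in> ?S. p < q}" by auto
  ultimately show ?thesis
    unfolding left_succ_values_eq S image_Un by auto
qed

section \<open>The recursion for successions and descents\<close>

lemma sum_left_succ_values_Suc:
  fixes f :: "nat set \<Rightarrow> nat \<Rightarrow> nat"
  shows "(\<Sum>\<sigma> | \<sigma> permutes {1..Suc m}. f (left_succ_values (Suc m) \<sigma>) (des_count (Suc m) \<sigma>)) =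
    (\<Sum>\<sigma> | \<sigma> permutes {1..m}. insertion_sum m f (left_succ_values m \<sigma>) (des_count m \<sigma>))"
  unfolding sum_permutations_word_insert
proof (rule sum.cong[OF refl])
  fix \<sigma> assume "\<sigma> \<in> {\<sigma>. \<sigma> permutes {1..m}}"
  then have \<sigma>: "\<sigma> permutes {1..m}" by simp
  define S J D where "S = succ_positions m \<sigma>" and "J = jump_positions m \<sigma>"
    and "D = des_positions m \<sigma>"
  define L where "L = left_succ_values m \<sigma>"
  define g where "g p = f (left_succ_values (Suc m) (\<sigma> \<circ> shift_perm m p))
    (des_count (Suc m) (\<sigma> \<circ> shift_perm m p))" for p
  let ?v = "\<lambda>q. \<sigma> (Suc q)"
  have fin: "finite S" "finite J" "finite D" by (simp_all add: S_def J_def D_def)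
  have L: "L = ?v ` S" by (simp add: L_def S_def left_succ_values_eq)
  have d: "des_count m \<sigma> = card D" by (simp add: D_def des_count_eq[OF \<sigma>])
  have inj: "\<sigma> i = \<sigma> j \<longleftrightarrow> i = j" for i j
    using permutes_inj[OF \<sigma>] by (auto dest: injD)
  have le: "\<sigma> i \<le> m" if "i \<le> m" for i
    using permutes_in_image[OF \<sigma>, of i] permutes_fixes_0[OF \<sigma>] that by (cases "i = 0") auto
  \<comment> \<open>The place right after the letter \<open>m\<close>, where insertion creates a
    succession; for \<open>m = 0\<close> it is the place after the conventional letter at position
    0.\<close>
  obtain p0 where p0: "p0 \<le> m" "\<sigma> p0 = m"
  proof (cases "m = 0")
    case True
    then show ?thesis using that[of 0] permutes_fixes_0[OF \<sigma>] by simp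
  next
    case False
    then have "m \<in> \<sigma> ` {1..m}" using permutes_image[OF \<sigma>] by simp
    then show ?thesis using that by auto
  qed
  have g: "g p = f (?v ` (S - {p}) \<union> (if p = p0 then {Suc m} else {}))
      (card (D - {p}) + (if p < m then 1 else 0))" if "p \<le> m" for p
    using that p0 inj[of p p0]
    by (simp add: g_def left_succ_values_insert[OF \<sigma>] des_count_insert[OF \<sigma>] S_def D_def)
  \<comment> \<open>The letter \<open>m\<close> is the largest, so it is last or followed by a
    descent.\<close>
  have p0_D: "p0 \<in> insert m D"
  proof (cases "p0 = m")
    case False
    with p0 have "\<sigma> (Suc p0) \<le> m" "\<sigma> (Suc p0) \<noteq> \<sigma> p0"
      using le[of "Suc p0"] inj[of "Suc p0" p0] by auto
    with False p0 show ?thesis by (auto simp: D_def des_positions_def)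
  qed simp
  have disj: "S \<inter> J = {}" "S \<inter> insert m D = {}" "J \<inter> insert m D = {}" "m \<notin> D"
    by (auto simp: S_def J_def D_def succ_positions_def jump_positions_def des_positions_def)
  have lt: "p < m" if "p \<in> S \<union> J \<union> D" for p
    using that by (auto simp: S_def J_def D_def succ_positions_def jump_positions_def des_positions_def)
  \<comment> \<open>The places are the successions, the jumps, \<open>p0\<close>, and the descents
    and the end other than \<open>p0\<close>; these four classes match the terms of
    \<open>insertion_sum\<close>.\<close>
  have part: "{..m} = S \<union> (J \<union> (insert p0 (insert m D - {p0})))"
  proof -
    have "{..m} = insert m {..<m}" by auto
    then show ?thesis using positions_partition[OF \<sigma>] p0_D by (auto simp: S_def J_def D_def)
  qed
  have "sum g {..m} = sum g S + (sum g J + (g p0 + sum g (insert m D - {p0})))"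
    unfolding part using fin disj p0_D
    by (subst sum.union_disjoint; (subst sum.union_disjoint)?; (subst sum.insert)?) auto
  also have "sum g S = (\<Sum>i\<in>L. f (L - {i}) (Suc (card D)))"
  proof -
    have "sum g S = (\<Sum>p\<in>S. f (L - {?v p}) (Suc (card D)))"
    proof (rule sum.cong[OF refl])
      fix p assume p: "p \<in> S"
      then have "p \<noteq> p0" "p \<notin> D" using disj p0_D by auto
      moreover have "?v ` (S - {p}) = L - {?v p}" using p inj by (auto simp: L)
      ultimately show "g p = f (L - {?v p}) (Suc (card D))"
        using g[of p] lt[of p] p by simp
    qed
    also have "\<dots> = (\<Sum>i\<in>L. f (L - {i}) (Suc (card D)))"
      unfolding L using inj_on_shift[OF \<sigma>] by (subst sum.reindex) (simp_all add: o_def)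
    finally show ?thesis .
  qed
  also have "sum g J = (\<Sum>p\<in>J. f L (Suc (card D)))"
  proof (rule sum.cong[OF refl])
    fix p assume p: "p \<in> J"
    then have "p \<noteq> p0" "p \<notin> D" "p \<notin> S" using disj p0_D by auto
    then show "g p = f L (Suc (card D))" using g[of p] lt[of p] p by (simp add: L)
  qed
  also have "g p0 = f (insert (Suc m) L) (card D)"
  proof -
    have "p0 \<notin> S" using disj p0_D by auto
    moreover have "card (D - {p0}) + (if p0 < m then 1 else 0) = card D"
    proof (cases "p0 = m")
      case False
      then have "p0 \<in> D" "p0 < m" using p0_D lt by auto
      then show ?thesis using card_Suc_Diff1[OF fin(3)] by simp
    qed (use disj in simp)
    ultimately show ?thesis using g[OF p0(1)] by (simp add: L)
  qed
  \<comment> \<open>A descent gap trades its descent for a new one, and appending at the end adds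
    none.\<close>
  also have "sum g (insert m D - {p0}) = (\<Sum>p\<in>insert m D - {p0}. f L (card D))"
  proof (rule sum.cong[OF refl])
    fix p assume p: "p \<in> insert m D - {p0}"
    then have "p \<notin> S" using disj by auto
    moreover have "card (D - {p}) + (if p < m then 1 else 0) = card D"
    proof (cases "p = m")
      case False
      then have "p \<in> D" "p < m" using p lt by auto
      then show ?thesis using card_Suc_Diff1[OF fin(3)] by simp
    qed (use disj in simp)
    moreover have "p \<le> m" using p lt by fastforce
    ultimately show "g p = f L (card D)" using g[of p] p by (simp add: L)
  qed
  finally have "sum g {..m} = (\<Sum>i\<in>L. f (L - {i}) (Suc (card D))) + (card J * f L (Suc (card D)) +
      (f (insert (Suc m) L) (card D) + card (insert m D - {p0}) * f L (card D)))"
    by simp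
  \<comment> \<open>Adding the end \<open>m\<close> to \<open>D\<close> and removing
    \<open>p0\<close> leaves the cardinality unchanged.\<close>
  moreover have "card (insert m D - {p0}) = card D"
    using p0_D fin disj by simp
  moreover have "card J = m - card L - card D"
    using jump_des_sum[OF \<sigma>] by (simp add: d L_def jump_count_eq J_def)
  ultimately show "(\<Sum>p\<le>m. f (left_succ_values (Suc m) (\<sigma> \<circ> shift_perm m p))
      (des_count (Suc m) (\<sigma> \<circ> shift_perm m p))) =
      insertion_sum m f (left_succ_values m \<sigma>) (des_count m \<sigma>)"
    by (simp add: g_def insertion_sum_def d flip: L_def)
qed

section \<open>Equidistribution and the bijection\<close>

text \<open>Both sums obey the same recursion. The weight \<open>f\<close> must vary in the
  induction, since the step applies the hypothesis to \<open>insertion_sum m f\<close>.\<close>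

lemma left_succ_fixed_points_equidistributed:
  fixes f :: "nat set \<Rightarrow> nat \<Rightarrow> nat"
  shows "(\<Sum>\<sigma> | \<sigma> permutes {1..n}. f (left_succ_values n \<sigma>) (des_count n \<sigma>)) =
    (\<Sum>\<pi> | \<pi> permutes {1..n}. f (fixed_points n \<pi>) (drop_count n \<pi>))"
proof (induction n arbitrary: f)
  case 0
  show ?case
    by (simp add: left_succ_values_def fixed_points_def des_count_def drop_count_def)
next
  case (Suc m)
  show ?case
    unfolding sum_left_succ_values_Suc sum_fixed_points_Suc by (rule Suc.IH)
qed

theorem theorem4p3:
  fixes n :: nat and I :: "nat set"
  assumes "n \<ge> 1" and "I \<subseteq> {1..n}"
  shows "\<exists>\<Phi>. bij_betw \<Phi> (perms_with_left_succ n I) (perms_with_fixed_points n I) \<and>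
    (\<forall>\<sigma> \<in> perms_with_left_succ n I.
      jump_count n \<sigma> = exc_count n (\<Phi> \<sigma>) \<and> des_count n \<sigma> = drop_count n (\<Phi> \<sigma>))"
proof -
  let ?A = "perms_with_left_succ n I" and ?B = "perms_with_fixed_points n I"
  have fin: "finite {\<sigma>. \<sigma> permutes {1..n}}" by (simp add: finite_permutations)
  have "card {\<sigma> \<in> ?A. des_count n \<sigma> = k} = card {\<pi> \<in> ?B. drop_count n \<pi> = k}" for k
  proof -
    \<comment> \<open>With an indicator as weight, the two sums count the fibres over
      \<open>k\<close>.\<close>
    let ?f = "\<lambda>X d. if X = I \<and> d = k then 1 else 0 :: nat"
    have "card {\<sigma> \<in> ?A. des_count n \<sigma> = k} =
        (\<Sum>\<sigma> | \<sigma> permutes {1..n}. ?f (left_succ_values n \<sigma>) (des_count n \<sigma>))"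
      using fin by (simp add: sum.If_cases perms_with_left_succ_def Int_def conj_ac)
    also have "\<dots> = (\<Sum>\<pi> | \<pi> permutes {1..n}. ?f (fixed_points n \<pi>) (drop_count n \<pi>))"
      by (rule left_succ_fixed_points_equidistributed)
    also have "\<dots> = card {\<pi> \<in> ?B. drop_count n \<pi> = k}"
      using fin by (simp add: sum.If_cases perms_with_fixed_points_def Int_def conj_ac)
    finally show ?thesis .
  qed
  moreover have "finite ?A" "finite ?B"
    using fin by (auto simp: perms_with_left_succ_def perms_with_fixed_points_def)
  ultimately obtain \<Phi> where \<Phi>: "bij_betw \<Phi> ?A ?B"
    and des: "\<And>\<sigma>. \<sigma> \<in> ?A \<Longrightarrow> drop_count n (\<Phi> \<sigma>) = des_count n \<sigma>"
    using ex_bij_betw_preserving[of ?A ?B "des_count n" "drop_count n"] by blast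
  \<comment> \<open>Both triples of statistics add up to \<open>n\<close>; the sets have the common
    cardinality of \<open>I\<close> and des equals drop, so the remaining terms agree.\<close>
  have "jump_count n \<sigma> = exc_count n (\<Phi> \<sigma>)" if "\<sigma> \<in> ?A" for \<sigma>
  proof -
    have "\<Phi> \<sigma> \<in> ?B" using \<Phi> that by (auto dest: bij_betwE)
    then show ?thesis
      using that des[OF that] jump_des_sum[of \<sigma> n] exc_drop_sum[of n "\<Phi> \<sigma>"]
      by (simp add: perms_with_left_succ_def perms_with_fixed_points_def)
  qed
  with \<Phi> des show ?thesis by auto
qed

end
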